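(* Let $p>2$ be a prime number, $k\ge 2$ an integer, $\zeta$ a primitive $p^k$-th root of unity, $H=[\zeta^{a_{ij}}]$ an $n\times n$ normalized Butson-Hadamard matrix, $H'=[a_{ij}]$ (entries in $\mathbb{Z}_{p^k}$), and $N$ the set of all $p^k$-th roots of unity. Let $A_k,B_k,C_k,D_k$ be the codes over $\mathbb{Z}_{p^k}$ obtained from $H$ as described in the context ($D_k$ being considered when $n=p^k$), and let $G_2(A_k),\dots,G_2(D_k)$ be their images under the Gray map $G_2$. Then their minimum Hamming distances satisfy $$d_{G_2(A_k)}=n(p-1)p^{k-2},\qquad d_{G_2(B_k)}=n-1,\qquad d_{G_2(C_k)}=n,\qquad d_{G_2(D_k)}\in\{n,n+1\}.$$
   Context: A Butson-Hadamard matrix of order $n$ (here with entries $p^k$-th roots of unity) is an $n\times n$ matrix $H$ with $HH^*=nI_n$; it is normalized if its first row and column consist entirely of 1s. Codes: for $u=\zeta^s\in N$ the exponent matrix of $uH$ is $[a_{ij}+s]$ over $\mathbb{Z}_{p^k}$. $A_k$ consists of the rows of $H'$ with the first column deleted; $B_k$ consists of the rows of the exponent matrices of all $uH$, $u\in N$, with the first column deleted; $C_k$ consists of the rows of the exponent matrices of all $uH$, $u\in N$; $D_k$ (for $n=p^k$) consists of the words $(a_{i1}+s,\dots,a_{in}+s,a_{ic})$, $1\le i\le n$, $s\in\mathbb{Z}_{p^k}$, for a fixed noninitial column index $c\in\{2,\dots,n\}$. Gray map $G_2:\mathbb{Z}_{p^k}\to\mathbb{Z}_p^{p^{k-1}}$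 (elements of $\mathbb{Z}_{p^k}$ represented by integers $0\le u\le p^k-1$): if $u\le p^{k-1}$, then $G_2(u)$ has 1 in its first $u$ coordinates and 0 elsewhere; if $u\ge p^{k-1}+1$, write $u=qp^{k-1}+r$ with $0\le r<p^{k-1}$, and then $G_2(u)=(q,q,\dots,q)+G_2(r)$. $G_2$ is applied to words coordinatewise, with the results concatenated. *)

theory Defs
  imports
    "HOL-Computational_Algebra.Primes"
    "Jordan_Normal_Form.Schur_Decomposition"
begin

definition roots_of_unity :: "nat \<Rightarrow> complex set" where
  "roots_of_unity m = {u. u ^ m = 1}"

definition primitive_root_of_unity :: "nat \<Rightarrow> complex \<Rightarrow> bool" where
  "primitive_root_of_unity m z \<longleftrightarrow>
     m > 0 \<and> z ^ m = 1 \<and> (\<forall>j. 0 < j \<and> j < m \<longrightarrow> z ^ j \<noteq> 1)"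

definition butson_hadamard :: "nat \<Rightarrow> nat \<Rightarrow> complex mat \<Rightarrow> bool" where
  "butson_hadamard m n H \<longleftrightarrow>
     H \<in> carrier_mat n n \<and> elements_mat H \<subseteq> roots_of_unity m \<and>
     H * mat_adjoint H = of_nat n \<cdot>\<^sub>m 1\<^sub>m n"

definition normalized :: "complex mat \<Rightarrow> bool" where
  "normalized H \<longleftrightarrow>
     (\<forall>j < dim_col H. H $$ (0, j) = 1) \<and> (\<forall>i < dim_row H. H $$ (i, 0) = 1)"

text \<open>The residue ring of the integers modulo \<open>m\<close> is represented by \<open>{0..<m}\<close>, the elements
  being natural numbers; a word is a list and a code is a set of words. Indices start from 0.\<close>

definition exponent_matrix :: "nat \<Rightarrow> complex \<Rightarrow> complex mat \<Rightarrow> nat mat" where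
  "exponent_matrix m \<zeta> M = map_mat (\<lambda>z. THE a. a < m \<and> \<zeta> ^ a = z) M"

definition row_words :: "'a mat \<Rightarrow> 'a list set" where
  "row_words M = (\<lambda>i. list_of_vec (row M i)) ` {..<dim_row M}"

definition code_A :: "nat mat \<Rightarrow> nat list set" where
  "code_A H' = tl ` row_words H'"

definition code_C :: "nat \<Rightarrow> complex \<Rightarrow> complex mat \<Rightarrow> nat list set" where
  "code_C m \<zeta> H = (\<Union>u \<in> roots_of_unity m. row_words (exponent_matrix m \<zeta> (u \<cdot>\<^sub>m H)))"

definition code_B :: "nat \<Rightarrow> complex \<Rightarrow> complex mat \<Rightarrow> nat list set" where
  "code_B m \<zeta> H =
     (\<Union>u \<in> roots_of_unity m. tl ` row_words (exponent_matrix m \<zeta> (u \<cdot>\<^sub>m H)))"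

text \<open>The appended last coordinate is the unshifted entry in column \<open>c\<close>.\<close>

definition code_D :: "nat \<Rightarrow> nat mat \<Rightarrow> nat \<Rightarrow> nat list set" where
  "code_D m H' c =
     {map (\<lambda>j. (H' $$ (i, j) + s) mod m) [0..<dim_col H'] @ [H' $$ (i, c)] | i s.
        i < dim_row H' \<and> s < m}"

definition unary_word :: "nat \<Rightarrow> nat \<Rightarrow> nat list" where
  "unary_word l u = replicate u 1 @ replicate (l - u) 0"

definition gray2 :: "nat \<Rightarrow> nat \<Rightarrow> nat \<Rightarrow> nat list" where
  "gray2 p k u =
     (let l = p ^ (k - 1) in
      if u \<le> l then unary_word l u
      else map (\<lambda>x. (u div l + x) mod p) (unary_word l (u mod l)))"

definition gray2_code :: "nat \<Rightarrow> nat \<Rightarrow> nat list set \<Rightarrow> nat list set" where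
  "gray2_code p k C = (\<lambda>w. concat (map (gray2 p k) w)) ` C"

text \<open>Only meaningful for words of equal length.\<close>

definition hamming_dist :: "'a list \<Rightarrow> 'a list \<Rightarrow> nat" where
  "hamming_dist x y = card {i. i < length x \<and> x ! i \<noteq> y ! i}"

text \<open>Only meaningful for codes with at least two words; the infimum is then attained.\<close>

definition min_dist :: "'a list set \<Rightarrow> nat" where
  "min_dist C = Inf {hamming_dist x y | x y. x \<in> C \<and> y \<in> C \<and> x \<noteq> y}"

text \<open>Exponents are unique, so the descriptions in \<open>exponent_matrix\<close> are proper, and multiplying
  a matrix by a power of the primitive root shifts its exponent matrix.\<close>

lemma primitive_root_power_inj:
  assumes "primitive_root_of_unity m \<zeta>" "a < m" "b < m" "\<zeta> ^ a = \<zeta> ^ b"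
  shows "a = b"
proof -
  have nz: "\<zeta> \<noteq> 0"
    using assms(1) unfolding primitive_root_of_unity_def by (auto simp: power_0_left)
  have *: "x = y" if "x \<le> y" "y < m" "\<zeta> ^ x = \<zeta> ^ y" for x y :: nat
  proof (rule ccontr)
    assume "x \<noteq> y"
    have "\<zeta> ^ (y - x) = 1"
      using that nz by (simp add: power_diff)
    moreover have "0 < y - x" "y - x < m" using that \<open>x \<noteq> y\<close> by auto
    ultimately show False using assms(1) unfolding primitive_root_of_unity_def by blast
  qed
  show ?thesis using *[of a b] *[of b a] assms by (cases "a \<le> b") auto
qed

lemma exponent_matrix_shift:
  assumes "primitive_root_of_unity m \<zeta>"
  shows "exponent_matrix m \<zeta> (\<zeta> ^ s \<cdot>\<^sub>m map_mat (\<lambda>a. \<zeta> ^ a) E) = map_mat (\<lambda>a. (a + s) mod m) E"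
proof -
  have m: "m > 0" "\<zeta> ^ m = 1" using assms by (auto simp: primitive_root_of_unity_def)
  have "\<zeta> ^ (a mod m) = \<zeta> ^ a" for a
    using m by (metis div_mult_mod_eq mult_1 power_add power_mult power_one mult.commute)
  then have "(THE b. b < m \<and> \<zeta> ^ b = \<zeta> ^ s * \<zeta> ^ a) = (a + s) mod m" for a
    using m primitive_root_power_inj[OF assms]
    by (intro the_equality) (auto simp: power_add mult.commute)
  then show ?thesis unfolding exponent_matrix_def by (intro eq_matI) auto
qed

end

theory Submission
  imports Defs
begin

text \<open>With \<open>l = p ^ (k - 1)\<close>, the Hamming distance of the Gray images of two residues depends only on
  their difference, through a weight that is at most \<open>l\<close>, is 1 at 1, positive off 0, and sums to
  \<open>(p - 1) * l\<close> over each residue class modulo \<open>l\<close>. The cyclotomic polynomial of order \<open>p ^ k\<close> is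
  irreducible by Eisenstein's criterion, so a vanishing sum of \<open>n\<close> roots of unity uses all exponents
  in a class modulo \<open>l\<close> equally often. Hence any shifts of two distinct rows have Gray images at
  distance exactly \<open>n * (p - 1) * p ^ (k - 2)\<close>, which is at least \<open>n\<close>. Two shifts of the same row
  are at distance at least the length of the row, with equality for the shifts 0 and 1. Deleting the
  constant first column changes no distance between unshifted rows, and otherwise lowers a distance
  by at most \<open>l\<close>.\<close>

subsection \<open>Cyclotomic polynomials of prime power order\<close>

text \<open>As \<open>P\<close> does not divide the constant coefficient of \<open>g\<close>, the
  convolution formula carries divisibility by \<open>P\<close> from the coefficients of
  \<open>f\<close> to those of \<open>h\<close>, from the lowest degree upwards. If \<open>g\<close>
  had positive degree, this would reach the leading coefficient of \<open>h\<close>.\<close>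

lemma eisenstein_factor_degree_0:
  fixes f g h :: "int poly"
  assumes P: "prime P" and fgh: "f = g * h"
    and low: "\<And>i. i < degree f \<Longrightarrow> P dvd coeff f i" and lead: "\<not> P dvd lead_coeff f"
    and g0: "\<not> P dvd coeff g 0"
  shows "degree g = 0"
proof (rule ccontr)
  assume g: "degree g \<noteq> 0"
  have "f \<noteq> 0" using lead by auto
  then have deg: "degree f = degree g + degree h"
    using fgh degree_mult_eq by force
  have "i < degree f \<longrightarrow> P dvd coeff h i" for i
  proof (induction i rule: less_induct)
    case (less i)
    show ?case
    proof
      assume i: "i < degree f"
      have "coeff f i = (\<Sum>j\<le>i. coeff g j * coeff h (i - j))"
        unfolding fgh by (rule coeff_mult)
      also have "\<dots> = coeff g 0 * coeff h i + (\<Sum>j\<in>{..i} - {0}. coeff g j * coeff h (i - j))"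
        by (subst sum.remove[of _ 0]) auto
      finally have eq: "coeff f i = \<dots>" .
      have "P dvd (\<Sum>j\<in>{..i} - {0}. coeff g j * coeff h (i - j))"
        using less i by (intro dvd_sum dvd_mult) auto
      then have "P dvd coeff g 0 * coeff h i"
        using low[OF i] eq by (metis dvd_add_left_iff)
      then show "P dvd coeff h i" using g0 P by (simp add: prime_dvd_mult_iff)
    qed
  qed
  then have "P dvd lead_coeff h" using deg g by simp
  then show False using lead unfolding fgh by (simp add: lead_coeff_mult)
qed

text \<open>By \<open>sq\<close>, one of the two factors has a constant coefficient prime to
  \<open>P\<close>; that factor is constant.\<close>

lemma eisenstein_criterion:
  fixes f g h :: "int poly"
  assumes P: "prime P" and fgh: "f = g * h"
    and low: "\<And>i. i < degree f \<Longrightarrow> P dvd coeff f i" and lead: "\<not> P dvd lead_coeff f"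
    and sq: "\<not> P ^ 2 dvd coeff f 0"
  shows "degree g = 0 \<or> degree h = 0"
proof -
  have "\<not> (P dvd coeff g 0 \<and> P dvd coeff h 0)"
    using sq mult_dvd_mono[of P "coeff g 0" P "coeff h 0"]
    by (auto simp: fgh coeff_mult_0 power2_eq_square)
  then show ?thesis
    using eisenstein_factor_degree_0[OF P fgh low lead]
      eisenstein_factor_degree_0[OF P, of f h g] fgh low lead by (auto simp: mult.commute)
qed

text \<open>For \<open>l = p ^ e\<close> this is the cyclotomic polynomial of order \<open>p ^ Suc e\<close>.\<close>

definition prime_power_cyclotomic :: "nat \<Rightarrow> nat \<Rightarrow> int poly" where
  "prime_power_cyclotomic p l = (\<Sum>q<p. monom 1 (q * l))"

lemma coeff_prime_power_cyclotomic:
  assumes "l > 0"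
  shows "coeff (prime_power_cyclotomic p l) d = (if l dvd d \<and> d div l < p then 1 else 0)"
proof -
  have "coeff (prime_power_cyclotomic p l) d = (\<Sum>q<p. if q = d div l \<and> l dvd d then 1 else 0)"
    unfolding prime_power_cyclotomic_def coeff_sum
    using assms by (intro sum.cong) auto
  also have "\<dots> = (if l dvd d \<and> d div l < p then 1 else 0)" by (cases "l dvd d") auto
  finally show ?thesis .
qed

lemma prime_power_cyclotomic_times:
  "prime_power_cyclotomic p l * (monom 1 l - 1) = monom 1 (p * l) - 1"
proof -
  have "prime_power_cyclotomic p l = (\<Sum>q<p. monom 1 l ^ q)"
    unfolding prime_power_cyclotomic_def by (simp add: monom_power mult.commute)
  then show ?thesis
    using power_diff_1_eq[of "monom (1::int) l" p] by (simp add: monom_power mult.commute)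
qed

lemma degree_prime_power_cyclotomic:
  assumes "l > 0" "p > 0"
  shows "degree (prime_power_cyclotomic p l) = (p - 1) * l"
proof (rule antisym)
  show "degree (prime_power_cyclotomic p l) \<le> (p - 1) * l"
  proof (rule degree_le, intro allI impI)
    fix i assume i: "(p - 1) * l < i"
    have "\<not> (l dvd i \<and> i div l < p)"
    proof
      assume *: "l dvd i \<and> i div l < p"
      then have "i = (i div l) * l" by simp
      also have "\<dots> \<le> (p - 1) * l" using * by (intro mult_right_mono) auto
      finally show False using i by simp
    qed
    then show "coeff (prime_power_cyclotomic p l) i = 0"
      using assms by (simp add: coeff_prime_power_cyclotomic)
  qed
  show "(p - 1) * l \<le> degree (prime_power_cyclotomic p l)"
    using assms by (intro le_degree) (simp add: coeff_prime_power_cyclotomic)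
qed

lemma monic_prime_power_cyclotomic:
  assumes "l > 0" "p > 0"
  shows "lead_coeff (prime_power_cyclotomic p l) = 1"
  using assms by (simp add: degree_prime_power_cyclotomic coeff_prime_power_cyclotomic)

text \<open>Congruence modulo \<open>p\<close> is expressed as divisibility by a constant
  polynomial, which keeps all polynomials over the integers. The inner binomial coefficients are
  multiples of \<open>p\<close>.\<close>

lemma const_dvd_freshman:
  fixes a :: "int poly"
  assumes "prime p"
  shows "[:int p:] dvd (a + 1) ^ p - (a ^ p + 1)"
proof -
  have p: "p > 0" using assms prime_gt_0_nat by blast
  have "(a + 1) ^ p = (\<Sum>k\<le>p. of_nat (p choose k) * a ^ k)"
    by (simp add: binomial_ring)
  also have "{..p} = insert 0 (insert p {1..<p})" using p by auto
  also have "(\<Sum>k\<in>\<dots>. of_nat (p choose k) * a ^ k) =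
      1 + (a ^ p + (\<Sum>k\<in>{1..<p}. of_nat (p choose k) * a ^ k))" using p by simp
  finally have eq: "(a + 1) ^ p - (a ^ p + 1) = (\<Sum>k\<in>{1..<p}. of_nat (p choose k) * a ^ k)"
    by simp
  have "[:int p:] dvd of_nat (p choose k)" if "k \<in> {1..<p}" for k
    using dvd_choose_prime[of k p] that assms p by (auto simp: of_nat_poly)
  then show ?thesis unfolding eq by (intro dvd_sum dvd_mult2) auto
qed

lemma const_dvd_freshman_prime_power:
  assumes "prime p"
  shows "[:int p:] dvd [:1, 1:] ^ (p ^ e) - (monom 1 (p ^ e) + 1)"
proof (induction e)
  case 0
  then show ?case by (simp add: monom_altdef one_pCons)
next
  case (Suc e)
  let ?a = "[:1, 1:] ^ (p ^ e) :: int poly" and ?b = "monom 1 (p ^ e) :: int poly"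
  \<comment> \<open>A difference divides the difference of the powers, so the congruence survives
    raising to the power \<open>p\<close>.\<close>
  have "?a - (?b + 1) dvd ?a ^ p - (?b + 1) ^ p"
    by (simp add: power_diff_sumr2)
  then have "[:int p:] dvd ?a ^ p - (?b + 1) ^ p" using Suc dvd_trans by blast
  moreover have "[:int p:] dvd (?b + 1) ^ p - (?b ^ p + 1)"
    using assms by (rule const_dvd_freshman)
  ultimately have "[:int p:] dvd (?a ^ p - (?b + 1) ^ p) + ((?b + 1) ^ p - (?b ^ p + 1))"
    by (rule dvd_add)
  then show ?case by (simp add: monom_power power_mult[symmetric] algebra_simps)
qed

text \<open>Substituting \<open>X + 1\<close> into the geometric series identity gives
  \<open>F(X + 1) * X ^ l = X ^ (p * l)\<close> modulo \<open>p\<close>. The power of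
  \<open>X\<close> cancels because \<open>[:int p:]\<close> is a prime element that does not divide
  it.\<close>

lemma const_dvd_shifted_prime_power_cyclotomic:
  fixes p e :: nat
  assumes "prime p"
  defines "l \<equiv> p ^ e"
  shows "[:int p:] dvd pcompose (prime_power_cyclotomic p l) [:1, 1:] - monom 1 ((p - 1) * l)"
proof -
  let ?X = "[:1, 1:] :: int poly"
  let ?F = "pcompose (prime_power_cyclotomic p l) ?X"
  have p: "p > 0" using assms prime_gt_0_nat by blast
  have mon: "pcompose (monom 1 n) ?X = ?X ^ n" for n
    by (simp add: monom_altdef pcompose_hom.hom_power pcompose_pCons)
  have "pcompose (prime_power_cyclotomic p l * (monom 1 l - 1)) ?X
      = pcompose (monom 1 (p * l) - 1) ?X"
    by (simp add: prime_power_cyclotomic_times)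
  then have F: "?F * (?X ^ l - 1) = ?X ^ (p * l) - 1"
    by (simp add: pcompose_mult pcompose_diff mon)
  have 1: "[:int p:] dvd ?X ^ l - (monom 1 l + 1)"
    unfolding l_def using assms(1) by (rule const_dvd_freshman_prime_power)
  have 2: "[:int p:] dvd ?X ^ (p * l) - (monom 1 (p * l) + 1)"
    using const_dvd_freshman_prime_power[OF assms(1), of "Suc e"] by (simp add: l_def)
  have "monom 1 l * (?F - monom 1 ((p - 1) * l)) =
      (?X ^ (p * l) - (monom 1 (p * l) + 1)) - ?F * (?X ^ l - (monom 1 l + 1))"
  proof -
    have "l + (p - 1) * l = p * l" using p by (cases p) auto
    then have "monom 1 l * monom (1::int) ((p - 1) * l) = monom 1 (p * l)"
      by (simp add: mult_monom)
    with F show ?thesis by (simp add: algebra_simps)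
  qed
  then have "[:int p:] dvd monom 1 l * (?F - monom 1 ((p - 1) * l))"
    using 1 2 by (simp add: dvd_diff dvd_mult)
  moreover have "prime_elem [:int p:]"
    using assms(1) by (intro lift_prime_elem_poly) auto
  moreover have "\<not> [:int p:] dvd monom 1 l"
    using assms(1) prime_gt_1_nat[of p] by (auto simp: const_poly_dvd_iff dest!: spec[of _ l])
  ultimately show ?thesis using prime_elem_dvd_mult_iff by blast
qed

text \<open>Eisenstein's criterion applies after substituting \<open>X + 1\<close>, which preserves
  the degrees of the factors. The constant coefficient becomes the value at 1, a sum of
  \<open>p\<close> ones.\<close>

lemma prime_power_cyclotomic_factor:
  assumes "prime p" and gh: "prime_power_cyclotomic p (p ^ e) = g * h"
  shows "degree g = 0 \<or> degree h = 0"
proof -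
  let ?X = "[:1, 1:] :: int poly"
  let ?l = "p ^ e"
  let ?F = "pcompose (prime_power_cyclotomic p ?l) ?X"
  have p: "p > 1" using assms prime_gt_1_nat by blast
  have deg: "degree ?F = (p - 1) * ?l"
    using p by (simp add: degree_pcompose degree_prime_power_cyclotomic)
  have "lead_coeff ?F = 1"
    using p by (subst lead_coeff_comp) (auto simp: monic_prime_power_cyclotomic)
  moreover have "int p dvd coeff ?F i" if "i < degree ?F" for i
    using const_dvd_shifted_prime_power_cyclotomic[OF assms(1), of e] that
    unfolding const_poly_dvd_iff deg by (auto dest: spec[of _ i])
  moreover have "coeff ?F 0 = int p"
  proof -
    have "coeff ?F 0 = poly (prime_power_cyclotomic p ?l) 1"
      by (simp add: poly_0_coeff_0[symmetric] poly_pcompose)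
    then show ?thesis by (simp add: prime_power_cyclotomic_def poly_sum poly_monom)
  qed
  moreover have "\<not> (int p)\<^sup>2 dvd int p"
    using p by (simp add: power2_eq_square)
  ultimately have "degree (pcompose g ?X) = 0 \<or> degree (pcompose h ?X) = 0"
    using eisenstein_criterion[of "int p" ?F "pcompose g ?X" "pcompose h ?X"] p assms(1)
    by (simp add: gh pcompose_mult)
  then show ?thesis by (simp add: degree_pcompose)
qed

section \<open>Integer polynomials vanishing at a root of unity\<close>

text \<open>With integral quotients, a factorisation obtained from this polynomial is directly
  subject to Eisenstein's criterion.\<close>

lemma minimal_int_poly:
  fixes z :: complex
  assumes "f0 \<noteq> 0" "poly (of_int_poly f0) z = 0"
  obtains m :: "int poly" where "m \<noteq> 0" "poly (of_int_poly m) z = 0"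
    "\<And>f. poly (of_int_poly f) z = 0 \<Longrightarrow> m dvd f"
proof -
  let ?R = "\<lambda>f :: int poly. f \<noteq> 0 \<and> poly (of_int_poly f) z = 0"
  obtain m where m: "?R m" and least: "\<And>f. ?R f \<Longrightarrow> degree m \<le> degree f"
    using ex_has_least_nat[of ?R f0 degree] assms by blast
  \<comment> \<open>By Gauss' lemma, a primitive polynomial dividing a scalar multiple of \<open>f\<close> divides \<open>f\<close>, so that
    pseudo-division suffices.\<close>
  let ?m = "primitive_part m"
  have "poly (of_int_poly m) z = of_int (content m) * poly (of_int_poly ?m) z"
    by (metis content_times_primitive_part of_int_hom.map_poly_hom_smult poly_smult)
  then have root: "poly (of_int_poly ?m) z = 0" using m by simp
  have "?m dvd f" if f: "poly (of_int_poly f) z = 0" for f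
  proof -
    obtain a q where a: "a \<noteq> 0" and aq: "smult a f = m * q + pseudo_mod f m"
      using pseudo_mod(1)[of m f] m by blast
    have "of_int_poly (smult a f) = of_int_poly m * of_int_poly q + (of_int_poly (pseudo_mod f m) :: complex poly)"
      unfolding aq by (simp add: hom_distribs)
    then have "poly (of_int_poly (pseudo_mod f m)) z = 0"
      using f m by (metis add_0 mult_zero_left mult_zero_right of_int_hom.map_poly_hom_smult
          poly_add poly_mult poly_smult)
    then have "pseudo_mod f m = 0"
      using pseudo_mod(2)[of m f] m least[of "pseudo_mod f m"] by fastforce
    then have "m dvd smult a f" using aq by simp
    then have "?m dvd smult (unit_factor a) (primitive_part f)"
      by (metis primitive_part_dvd_primitive_partI primitive_part_smult)
    then have "?m dvd primitive_part f"
      using a by (auto simp: sgn_if split: if_splits)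
    then show ?thesis by (metis content_times_primitive_part dvd_smult)
  qed
  then show thesis using that[of ?m] m root by simp
qed

text \<open>The minimal polynomial of \<open>z\<close> is a nonconstant divisor of the cyclotomic
  one. By irreducibility the cofactor is constant, and it is a unit because the cyclotomic
  polynomial is monic.\<close>

lemma prime_power_cyclotomic_dvd:
  fixes z :: complex
  assumes p: "prime p" and prim: "primitive_root_of_unity (p ^ Suc e) z"
    and f: "poly (of_int_poly f) z = 0"
  shows "prime_power_cyclotomic p (p ^ e) dvd f"
proof -
  let ?F = "prime_power_cyclotomic p (p ^ e)"
  have p1: "p > 1" using p prime_gt_1_nat by blast
  have z: "z ^ (p * p ^ e) = 1" "z ^ (p ^ e) \<noteq> 1"
    using prim p1 by (auto simp: primitive_root_of_unity_def)
  have "poly (of_int_poly (?F * (monom 1 (p ^ e) - 1))) z = 0"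
    unfolding prime_power_cyclotomic_times using z
    by (simp add: hom_distribs poly_monom)
  then have root: "poly (of_int_poly ?F) z = 0"
    using z by (simp add: hom_distribs poly_monom)
  have F0: "?F \<noteq> 0"
    using monic_prime_power_cyclotomic[of "p ^ e" p] p1 by auto
  obtain m where m: "m \<noteq> 0" "poly (of_int_poly m) z = 0"
    and min: "\<And>f. poly (of_int_poly f) z = 0 \<Longrightarrow> m dvd f"
    using minimal_int_poly[OF F0 root] by blast
  obtain h where h: "?F = m * h" using min[OF root] by (elim dvdE)
  have "degree m \<noteq> 0"
  proof
    assume "degree m = 0"
    then obtain c where "m = [:c:]" by (elim degree_eq_zeroE)
    then show False using m by simp
  qed
  then obtain c where c: "h = [:c:]"
    using prime_power_cyclotomic_factor[OF p h] by (elim disjE degree_eq_zeroE) auto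
  have "lead_coeff m * c = 1"
    using monic_prime_power_cyclotomic[of "p ^ e" p] p1 unfolding h c
    by (auto simp: mult.commute split: if_splits)
  then have "c = 1 \<or> c = - 1" by (metis zmult_eq_1_iff)
  then have "?F dvd m" unfolding h c by auto
  then show ?thesis using min[OF f] dvd_trans by blast
qed

subsection \<open>The Gray map\<close>

lemma hamming_dist_conv_filter:
  assumes "length x = length y"
  shows "hamming_dist x y = length (filter (\<lambda>(a, b). a \<noteq> b) (zip x y))"
  using assms unfolding hamming_dist_def length_filter_conv_card
  by (intro arg_cong[where f = card]) auto

lemma hamming_dist_append:
  assumes "length x = length y" "length x' = length y'"
  shows "hamming_dist (x @ x') (y @ y') = hamming_dist x y + hamming_dist x' y'"
  using assms by (simp add: hamming_dist_conv_filter)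

lemma hamming_dist_same [simp]: "hamming_dist x x = 0"
  by (simp add: hamming_dist_def)

text \<open>Equality of lengths belongs to the conclusion because the induction needs it for
  \<open>hamming_dist_append\<close>.\<close>

lemma hamming_dist_concat:
  assumes "\<And>j. j \<in> set js \<Longrightarrow> length (f j) = length (g j)"
  shows "hamming_dist (concat (map f js)) (concat (map g js)) = (\<Sum>j\<leftarrow>js. hamming_dist (f j) (g j))
    \<and> length (concat (map f js)) = length (concat (map g js))"
  using assms by (induction js) (auto simp: hamming_dist_append)

text \<open>Coordinate \<open>i\<close> of \<open>gray2 p k u\<close> is \<open>(u + (l - 1 - i)) div l mod p\<close>, so this is the Hamming
  distance between the Gray images of any two residues that differ by \<open>e\<close>.\<close>

definition gray_weight :: "nat \<Rightarrow> nat \<Rightarrow> nat \<Rightarrow> nat" where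
  "gray_weight p l e = card {r. r < l \<and> (r + e) div l mod p \<noteq> 0}"

lemma gray_weight_le: "gray_weight p l e \<le> l"
proof -
  have "card {r. r < l \<and> (r + e) div l mod p \<noteq> 0} \<le> card {..<l}"
    by (intro card_mono) auto
  then show ?thesis by (simp add: gray_weight_def)
qed

lemma gray_weight_1:
  assumes "l > 0" "p > 1"
  shows "gray_weight p l 1 = 1"
proof -
  have "{r. r < l \<and> (r + 1) div l mod p \<noteq> 0} = {l - 1}"
  proof (intro equalityI subsetI)
    fix r assume "r \<in> {r. r < l \<and> (r + 1) div l mod p \<noteq> 0}"
    then have "r < l" "(r + 1) div l \<noteq> 0" by (auto intro: Nat.gr0I)
    then have "\<not> r + 1 < l" by auto
    then show "r \<in> {l - 1}" using \<open>r < l\<close> by auto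
  qed (use assms in auto)
  then show ?thesis by (simp add: gray_weight_def)
qed

lemma gray_weight_pos:
  assumes "0 < e" "e < p * l" "p > 1"
  shows "gray_weight p l e > 0"
proof -
  have l: "l > 0" using assms by (cases l) auto
  have "\<exists>r<l. (r + e) div l mod p \<noteq> 0"
  \<comment> \<open>For small \<open>e\<close> the largest \<open>r\<close> produces exactly one
    carry; otherwise \<open>r = 0\<close> already gives a quotient strictly between 0 and
    \<open>p\<close>.\<close>
  proof (cases "e < l")
    case True
    have "(l - 1 + e) div l = 1"
      using True assms l by (intro div_nat_eqI) auto
    then show ?thesis using l assms by (intro exI[of _ "l - 1"]) auto
  next
    case False
    then have "e div l > 0" "e div l < p"
      using assms l by (auto simp: div_greater_zero_iff less_mult_imp_div_less)
    then show ?thesis using l by (intro exI[of _ 0]) auto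
  qed
  then show ?thesis unfolding gray_weight_def by (subst card_gt_0_iff) auto
qed

lemma inj_on_shift_mod: "inj_on (\<lambda>i. (a + i) mod l) {..<l}" for a l :: nat
proof -
  have "i = j" if "i \<le> j" "j < l" "(a + i) mod l = (a + j) mod l" for i j
  proof -
    have "l dvd j - i" using that mod_eq_dvd_iff_nat[of "a + i" "a + j" l] by simp
    then show ?thesis using that by (auto dest: dvd_imp_le)
  qed
  then show ?thesis by (intro inj_onI) (metis lessThan_iff linorder_le_cases)
qed

lemma card_shift_nonzero_mod:
  fixes a p :: nat
  assumes "p > 0"
  shows "card {q. q < p \<and> (a + q) mod p \<noteq> 0} = p - 1"
proof -
  let ?f = "\<lambda>q. (a + q) mod p"
  have "?f ` {..<p} = {..<p}"
    using assms inj_on_shift_mod by (intro endo_inj_surj) auto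
  moreover have "?f ` {q. q < p \<and> ?f q \<noteq> 0} = ?f ` {..<p} - {0}" by auto
  moreover have "card (?f ` {q. q < p \<and> ?f q \<noteq> 0}) = card {q. q < p \<and> ?f q \<noteq> 0}"
    by (intro card_image inj_on_subset[OF inj_on_shift_mod]) auto
  ultimately show ?thesis using assms by simp
qed

text \<open>For fixed \<open>r\<close> the quotient runs through all residues modulo
  \<open>p\<close> as \<open>q\<close> varies, so exactly one of the \<open>p\<close> terms
  vanishes.\<close>

lemma sum_gray_weight_residue_class:
  assumes "l > 0" "p > 0"
  shows "(\<Sum>q<p. gray_weight p l (d + q * l)) = (p - 1) * l"
proof -
  have div: "(r + (d + q * l)) div l = (r + d) div l + q" for r q
    using assms div_mult_self1[of l "r + d" q] by (simp add: ac_simps)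
  have "(\<Sum>q<p. gray_weight p l (d + q * l)) =
      (\<Sum>q<p. \<Sum>r<l. if ((r + d) div l + q) mod p \<noteq> 0 then 1 else 0)"
    unfolding gray_weight_def div
    by (intro sum.cong refl) (simp add: sum.If_cases Int_def lessThan_def)
  also have "\<dots> = (\<Sum>r<l. \<Sum>q<p. if ((r + d) div l + q) mod p \<noteq> 0 then 1 else 0)"
    by (rule sum.swap)
  also have "\<dots> = (\<Sum>r<l. p - 1)"
    using card_shift_nonzero_mod[OF assms(2)]
    by (intro sum.cong refl) (simp add: sum.If_cases Int_def lessThan_def)
  finally show ?thesis by (simp add: mult.commute)
qed

lemma length_gray2:
  assumes "p > 0"
  shows "length (gray2 p k u) = p ^ (k - 1)"
  using assms by (auto simp: gray2_def unary_word_def Let_def less_imp_le)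

text \<open>Adding \<open>l - 1 - i\<close> to \<open>u\<close> produces a carry past a multiple of
  \<open>l\<close> exactly when \<open>i < u mod l\<close>, that is, where the unary word has a
  1.\<close>

lemma nth_gray2:
  fixes p k u i :: nat
  defines "l \<equiv> p ^ (k - 1)"
  assumes "p > 1" "i < l"
  shows "gray2 p k u ! i = (u + (l - 1 - i)) div l mod p"
proof -
  have unary: "unary_word l v ! i = (if i < v then 1 else 0)" if "v \<le> l" for v
    using that assms by (auto simp: unary_word_def nth_append)
  have len: "length (unary_word l v) = l" if "v \<le> l" for v
    using that by (simp add: unary_word_def)
  have l: "l > 0" and r: "u mod l < l" using assms by auto
  have "(v + (l - 1 - i)) div l = (if i < v then 1 else 0)" if "v < l" for v
    using that assms(3) by (auto intro!: div_nat_eqI)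
  note carry = this[OF r]
  have split: "u + (l - 1 - i) = u mod l + (l - 1 - i) + u div l * l"
    by (metis add.commute add.left_commute div_mult_mod_eq)
  have eq: "(u + (l - 1 - i)) div l = u div l + (if i < u mod l then 1 else 0)"
    by (subst split, subst div_mult_self1) (use l carry in simp_all)
  have gray: "gray2 p k u = (if u \<le> l then unary_word l u
      else map (\<lambda>x. (u div l + x) mod p) (unary_word l (u mod l)))"
    by (simp add: gray2_def l_def Let_def)
  consider "u < l" | "u = l" | "u > l" by linarith
  then show ?thesis
  proof cases
    case 1
    then show ?thesis using assms(2) unary[of u] unfolding gray eq by simp
  next
    \<comment> \<open>The boundary value falls under the first branch of \<open>gray2\<close>; its
      word of ones agrees with quotient 1 and remainder 0.\<close>
    case 2
    then show ?thesis using assms(2,3) unary[of u] l unfolding gray eq by simp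
  next
    case 3
    then show ?thesis using assms(3) unary[of "u mod l"] len[of "u mod l"] r unfolding gray eq
      by (simp add: less_imp_le)
  qed
qed

text \<open>The argument of the weight is \<open>v - u\<close> modulo \<open>p ^ Suc e\<close>,
  written without negative numbers. The remainders of \<open>u + (l - 1 - i)\<close> modulo
  \<open>l\<close> run through all values below \<open>l\<close>, and each of them plays the part of
  \<open>r\<close> in the weight.\<close>

lemma hamming_dist_gray2:
  fixes p e u v :: nat
  assumes p: "p > 1" and u: "u < p ^ Suc e"
  shows "hamming_dist (gray2 p (Suc e) u) (gray2 p (Suc e) v)
    = gray_weight p (p ^ e) ((v + (p ^ Suc e - u)) mod p ^ Suc e)"
proof -
  define l where "l = p ^ e"
  define w where "w = (v + (p ^ Suc e - u)) mod p ^ Suc e"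
  define t where "t = (v + (p ^ Suc e - u)) div p ^ Suc e"
  define f where "f i = (u + (l - 1 - i)) mod l" for i
  have l: "l > 0" using p by (simp add: l_def)
  \<comment> \<open>The extra multiples of \<open>p * l\<close> avoid subtraction and change
    quotients by \<open>l\<close> only by multiples of \<open>p\<close>.\<close>
  have shift: "v + p * l = u + w + p * t * l"
  proof -
    have "v + (p ^ Suc e - u) = w + t * p ^ Suc e" unfolding w_def t_def by (rule mod_div_mult_eq[symmetric])
    then show ?thesis using u by (simp add: l_def algebra_simps)
  qed
  have inj: "inj_on f {..<l}"
  proof (rule inj_onI)
    fix i j assume ij: "i \<in> {..<l}" "j \<in> {..<l}" "f i = f j"
    have "l - 1 - i = l - 1 - j"
      using ij inj_onD[OF inj_on_shift_mod[of u l], of "l - 1 - i" "l - 1 - j"]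
      unfolding f_def by auto
    then show "i = j" using ij by auto
  qed
  have onto: "f ` {..<l} = {..<l}"
    using l inj by (intro endo_inj_surj) (auto simp: f_def)
  have iff: "(u + (l - 1 - i)) div l mod p \<noteq> (v + (l - 1 - i)) div l mod p
      \<longleftrightarrow> (f i + w) div l mod p \<noteq> 0" if "i < l" for i
  proof -
    let ?x = "u + (l - 1 - i)"
    have "(v + (l - 1 - i)) div l mod p = ((v + (l - 1 - i)) div l + p) mod p" by simp
    also have "(v + (l - 1 - i)) div l + p = (v + (l - 1 - i) + p * l) div l" using l by simp
    also have "v + (l - 1 - i) + p * l = ?x + w + p * t * l" using shift by simp
    also have "\<dots> = f i + w + (?x div l + p * t) * l"
    proof -
      have "?x = f i + ?x div l * l" by (simp add: f_def)
      then show ?thesis by (simp add: algebra_simps)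
    qed
    also have "\<dots> div l = (f i + w) div l + ?x div l + p * t"
      using l by (subst div_mult_self1) simp_all
    also have "\<dots> mod p = ((f i + w) div l + ?x div l) mod p" by simp
    finally have eq: "(v + (l - 1 - i)) div l mod p = (?x div l + (f i + w) div l) mod p"
      by (simp add: add.commute)
    have "?x div l mod p = (?x div l + (f i + w) div l) mod p \<longleftrightarrow> p dvd (f i + w) div l"
      using mod_eq_dvd_iff_nat[of "?x div l" "?x div l + (f i + w) div l" p] by auto
    then show ?thesis unfolding eq by (auto simp: dvd_eq_mod_eq_0)
  qed
  have len: "length (gray2 p (Suc e) x) = l" for x
    using p by (simp add: length_gray2 l_def)
  have nth: "gray2 p (Suc e) x ! i = (x + (l - 1 - i)) div l mod p" if "i < l" for x i
    using nth_gray2[OF p, of i "Suc e" x] that by (simp add: l_def)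
  have "hamming_dist (gray2 p (Suc e) u) (gray2 p (Suc e) v)
      = card {i. i < l \<and> (f i + w) div l mod p \<noteq> 0}"
    unfolding hamming_dist_def len
    by (intro arg_cong[where f = card] Collect_cong conj_cong refl) (simp only: nth iff)
  also have "\<dots> = card (f ` {i. i < l \<and> (f i + w) div l mod p \<noteq> 0})"
    using inj by (intro card_image[symmetric]) (auto simp: inj_on_def)
  also have "f ` {i. i < l \<and> (f i + w) div l mod p \<noteq> 0} = {r. r < l \<and> (r + w) div l mod p \<noteq> 0}"
  proof -
    have "f ` {i. i < l \<and> (f i + w) div l mod p \<noteq> 0} = f ` {..<l} \<inter> {r. (r + w) div l mod p \<noteq> 0}"
      by auto
    then show ?thesis unfolding onto by auto
  qed
  finally show ?thesis by (simp add: gray_weight_def l_def w_def)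
qed

subsection \<open>Vanishing sums of roots of unity\<close>

text \<open>The number of \<open>t\<close> with \<open>d t = i\<close> is \<open>g (i mod p ^ e)\<close>: it is the coefficient of degree \<open>i\<close> of
  the product of the cyclotomic polynomial with a polynomial of degree less than \<open>p ^ e\<close>.\<close>

lemma sum_of_vanishing_root_sum:
  fixes z :: complex and d :: "'a \<Rightarrow> nat"
  assumes p: "prime p" and prim: "primitive_root_of_unity (p ^ Suc e) z"
    and fin: "finite I" and d: "\<And>t. t \<in> I \<Longrightarrow> d t < p ^ Suc e"
    and zero: "(\<Sum>t\<in>I. z ^ d t) = 0"
  obtains g :: "nat \<Rightarrow> int" where
    "\<And>\<phi>. (\<Sum>t\<in>I. \<phi> (d t)) = (\<Sum>r<p ^ e. g r * (\<Sum>q<p. \<phi> (r + q * p ^ e)))"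
proof -
  define l where "l = p ^ e"
  define F where "F = prime_power_cyclotomic p l"
  define f :: "int poly" where "f = (\<Sum>t\<in>I. monom 1 (d t))"
  have p0: "p > 0" and l: "l > 0" using p prime_gt_0_nat by (auto simp: l_def)
  have "poly (of_int_poly f) z = 0"
    using zero by (simp add: f_def hom_distribs poly_sum poly_monom)
  then have "F dvd f" unfolding F_def l_def using p prim by (intro prime_power_cyclotomic_dvd)
  then obtain g where g: "f = F * g" by (elim dvdE)
  have F: "F \<noteq> 0" "degree F = (p - 1) * l"
    using monic_prime_power_cyclotomic[OF l p0] degree_prime_power_cyclotomic[OF l p0]
    by (auto simp: F_def)
  have "degree f < p * l"
  proof -
    have "degree f \<le> p * l - 1"
      unfolding f_def using fin
    proof (intro degree_sum_le)
      fix t assume "t \<in> I"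
      then have "d t < p * l" using d by (simp add: l_def)
      then show "degree (monom (1::int) (d t)) \<le> p * l - 1" by (simp add: degree_monom_eq)
    qed
    then show ?thesis using p0 l by (metis Suc_pred' le_imp_less_Suc mult_pos_pos)
  qed
  moreover have "p * l = (p - 1) * l + l" using p0 by (cases p) auto
  ultimately have deg: "degree g < l"
    using l F g degree_mult_eq[of F g] by (cases "g = 0") auto
  \<comment> \<open>As \<open>degree g < l\<close>, the translates of \<open>g\<close> by multiples
    of \<open>l\<close> do not overlap, so each block of \<open>l\<close> coefficients of
    \<open>f\<close> is a copy of \<open>g\<close>.\<close>
  have coeff_f: "coeff f (r + q * l) = coeff g r" if r: "r < l" and q: "q < p" for r q
  proof -
    have "coeff f (r + q * l) = (\<Sum>s<p. if r + q * l < s * l then 0 else coeff g (r + q * l - s * l))"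
      unfolding g F_def prime_power_cyclotomic_def
      unfolding sum_distrib_right coeff_sum
      by (intro sum.cong refl) (simp add: coeff_monom_mult)
    also have "\<dots> = (\<Sum>s<p. if s = q then coeff g r else 0)"
    proof (intro sum.cong refl)
      fix s assume "s \<in> {..<p}"
      consider "s = q" | "s < q" | "q < s" by linarith
      then show "(if r + q * l < s * l then 0 else coeff g (r + q * l - s * l))
          = (if s = q then coeff g r else 0)"
      proof cases
        case 2
        then obtain a where "q = s + Suc a" by (metis add_Suc_right less_imp_Suc_add)
        then have "r + q * l - s * l \<ge> l" by (simp add: algebra_simps)
        then show ?thesis using 2 deg by (simp add: coeff_eq_0)
      next
        case 3
        then obtain a where "s = q + Suc a" by (metis add_Suc_right less_imp_Suc_add)
        then show ?thesis using 3 r by (simp add: algebra_simps)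
      qed auto
    qed
    finally show ?thesis using q by simp
  qed
  show thesis
  proof (rule that)
    fix \<phi> :: "nat \<Rightarrow> int"
    have "(\<Sum>t\<in>I. \<phi> (d t)) = (\<Sum>t\<in>I. \<Sum>i<p * l. if d t = i then \<phi> i else 0)"
      using d by (intro sum.cong refl) (simp add: l_def)
    also have "\<dots> = (\<Sum>i<p * l. \<Sum>t\<in>I. if d t = i then \<phi> i else 0)" by (rule sum.swap)
    also have "\<dots> = (\<Sum>i<p * l. coeff f i * \<phi> i)"
      by (intro sum.cong refl) (auto simp: f_def coeff_sum sum_distrib_right intro!: sum.cong)
    also have "\<dots> = (\<Sum>q<p. \<Sum>i\<in>{q * l..<q * l + l}. coeff f i * \<phi> i)"
      by (rule sum.nat_group[symmetric])
    also have "\<dots> = (\<Sum>q<p. \<Sum>r<l. coeff g r * \<phi> (r + q * l))"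
    proof (rule sum.cong[OF refl])
      fix q assume q: "q \<in> {..<p}"
      have "(\<Sum>i\<in>{q * l..<q * l + l}. coeff f i * \<phi> i)
          = (\<Sum>r\<in>{0..<l}. coeff f (r + q * l) * \<phi> (r + q * l))"
        using sum.shift_bounds_nat_ivl[of "\<lambda>i. coeff f i * \<phi> i" 0 "q * l" l]
        by (simp add: add.commute)
      then show "(\<Sum>i\<in>{q * l..<q * l + l}. coeff f i * \<phi> i) = (\<Sum>r<l. coeff g r * \<phi> (r + q * l))"
        using q coeff_f by (simp add: atLeast0LessThan)
    qed
    also have "\<dots> = (\<Sum>r<l. coeff g r * (\<Sum>q<p. \<phi> (r + q * l)))"
      by (subst sum.swap) (simp add: sum_distrib_left)
    finally show "(\<Sum>t\<in>I. \<phi> (d t)) = (\<Sum>r<p ^ e. coeff g r * (\<Sum>q<p. \<phi> (r + q * p ^ e)))"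
      by (simp add: l_def)
  qed
qed

text \<open>Every residue class modulo \<open>p ^ e\<close> has the same total weight, so only the
  sum of all multiplicities matters. The factor \<open>p\<close> on the left avoids a
  division.\<close>

lemma sum_gray_weight_vanishing:
  fixes z :: complex and d :: "'a \<Rightarrow> nat"
  assumes p: "prime p" and prim: "primitive_root_of_unity (p ^ Suc e) z"
    and fin: "finite I" and d: "\<And>t. t \<in> I \<Longrightarrow> d t < p ^ Suc e"
    and zero: "(\<Sum>t\<in>I. z ^ d t) = 0"
  shows "p * (\<Sum>t\<in>I. gray_weight p (p ^ e) (d t)) = card I * (p - 1) * p ^ e"
proof -
  obtain g :: "nat \<Rightarrow> int" where
    g: "\<And>\<phi>. (\<Sum>t\<in>I. \<phi> (d t)) = (\<Sum>r<p ^ e. g r * (\<Sum>q<p. \<phi> (r + q * p ^ e)))"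
    using sum_of_vanishing_root_sum[OF p prim fin d zero] by blast
  have p0: "p > 0" using p prime_gt_0_nat by blast
  have "int p * (\<Sum>t\<in>I. int (gray_weight p (p ^ e) (d t)))
      = int p * (\<Sum>r<p ^ e. g r * int ((p - 1) * p ^ e))"
    using sum_gray_weight_residue_class[of "p ^ e" p] p0
    by (subst g[of "\<lambda>d. int (gray_weight p (p ^ e) d)"]) (simp flip: of_nat_sum)
  also have "\<dots> = int (card I) * int ((p - 1) * p ^ e)"
    \<comment> \<open>The constant function 1 shows that \<open>card I\<close> is \<open>p\<close>
      times the sum of all \<open>g r\<close>.\<close>
    using g[of "\<lambda>_. 1"] by (simp add: sum_distrib_right[symmetric])
  finally have "int (p * (\<Sum>t\<in>I. gray_weight p (p ^ e) (d t))) = int (card I * (p - 1) * p ^ e)"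
    by (simp only: of_nat_mult of_nat_sum mult.assoc)
  then show ?thesis by (simp only: of_nat_eq_iff)
qed

subsection \<open>The codes\<close>

text \<open>Distinct words have distinct indices, so it suffices to bound over indices; positivity
  of \<open>d\<close> makes the two words attaining it distinct.\<close>

lemma min_dist_image_eqI:
  assumes C: "C = F ` I"
    and lower: "\<And>a b. a \<in> I \<Longrightarrow> b \<in> I \<Longrightarrow> a \<noteq> b \<Longrightarrow> d \<le> hamming_dist (F a) (F b)"
    and ab: "a \<in> I" "b \<in> I" "hamming_dist (F a) (F b) = d" and d: "d > 0"
  shows "min_dist C = d"
  unfolding min_dist_def
proof (rule cInf_eq_minimum)
  have "F a \<noteq> F b" using ab d by auto
  then show "d \<in> {hamming_dist x y | x y. x \<in> C \<and> y \<in> C \<and> x \<noteq> y}"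
    using ab C by blast
next
  fix v assume "v \<in> {hamming_dist x y | x y. x \<in> C \<and> y \<in> C \<and> x \<noteq> y}"
  then show "d \<le> v" using lower by (auto simp: C)
qed

lemma list_of_row: "list_of_vec (row M i) = map (\<lambda>j. M $$ (i, j)) [0..<dim_col M]"
  by (simp add: row_def list_of_vec_vec)

text \<open>The \<open>m\<close> powers are distinct roots, and there are exactly \<open>m\<close>
  roots in total.\<close>

lemma roots_of_unity_eq_powers:
  assumes "primitive_root_of_unity m z"
  shows "roots_of_unity m = (\<lambda>s. z ^ s) ` {..<m}"
proof -
  have m: "m > 0" "z ^ m = 1" using assms by (auto simp: primitive_root_of_unity_def)
  have "(\<lambda>s. z ^ s) ` {..<m} \<subseteq> roots_of_unity m"
    using m by (auto simp: roots_of_unity_def power_mult[symmetric] mult.commute[of _ m])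
       (simp add: power_mult)
  moreover have "finite (roots_of_unity m)"
    unfolding roots_of_unity_def using m by (intro finite_roots_unity) auto
  moreover have "card ((\<lambda>s. z ^ s) ` {..<m}) = card (roots_of_unity m)"
    using m primitive_root_power_inj[OF assms]
    by (subst card_image) (auto simp: inj_on_def roots_of_unity_def card_roots_unity_eq)
  ultimately show ?thesis using card_subset_eq by metis
qed

lemma primitive_root_power_diff:
  assumes "primitive_root_of_unity m z" "a \<le> m"
  shows "z ^ (m - a) = cnj (z ^ a)"
proof -
  have m: "m > 0" "z ^ m = 1" using assms by (auto simp: primitive_root_of_unity_def)
  then have "norm z = 1" using power_eq_1_iff by fastforce
  then have "z ^ a * cnj (z ^ a) = 1"
    by (metis complex_norm_square norm_power of_real_1 power_one)
  moreover have "z ^ (m - a) * z ^ a = 1" using m assms by (simp flip: power_add)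
  ultimately show ?thesis by (metis mult.assoc mult.commute mult_1)
qed

lemma primitive_root_power_mod:
  assumes "primitive_root_of_unity m z"
  shows "z ^ (a mod m) = z ^ a"
  using assms unfolding primitive_root_of_unity_def
  by (metis div_mult_mod_eq mult_1 mult.commute power_add power_mult power_one)

lemma mult_mat_adjoint_index:
  fixes H :: "complex mat"
  assumes "H \<in> carrier_mat n n" "i < n" "j < n"
  shows "(H * mat_adjoint H) $$ (i, j) = (\<Sum>t<n. H $$ (i, t) * cnj (H $$ (j, t)))"
  using assms by (auto simp: mat_adjoint_def scalar_prod_def mat_of_rows_def atLeast0LessThan
      intro!: sum.cong)

section \<open>Distances between shifted rows of the exponent matrix\<close>

locale butson_exponents =
  fixes p e n :: nat and \<zeta> :: complex and E :: "nat mat"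
  assumes prime: "prime p" and p_gt_2: "p > 2" and n_pos: "n > 0" and e_pos: "e > 0"
    and primitive: "primitive_root_of_unity (p ^ Suc e) \<zeta>"
    and carrier: "E \<in> carrier_mat n n"
    and entry_less: "\<And>i t. i < n \<Longrightarrow> t < n \<Longrightarrow> E $$ (i, t) < p ^ Suc e"
    and first_column: "\<And>i. i < n \<Longrightarrow> E $$ (i, 0) = 0"
    and orthogonal: "\<And>i j. i < n \<Longrightarrow> j < n \<Longrightarrow> i \<noteq> j \<Longrightarrow>
      (\<Sum>t<n. \<zeta> ^ (E $$ (i, t)) * cnj (\<zeta> ^ (E $$ (j, t)))) = 0"
begin

definition letter :: "nat \<Rightarrow> nat \<Rightarrow> nat \<Rightarrow> nat" where
  "letter i s t = (E $$ (i, t) + s) mod p ^ Suc e"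

text \<open>A common form for all four codes, indexed by a row and a shift: \<open>js\<close> omits
  column 0 for the codes A and B, the shift is 0 for A, and D appends one more block.\<close>

definition gray_word :: "nat list \<Rightarrow> nat \<times> nat \<Rightarrow> nat list" where
  "gray_word js = (\<lambda>(i, s). concat (map (gray2 p (Suc e)) (map (letter i s) js)))"

definition cell_dist :: "nat \<Rightarrow> nat \<Rightarrow> nat \<Rightarrow> nat \<Rightarrow> nat \<Rightarrow> nat" where
  "cell_dist i s j s' t = hamming_dist (gray2 p (Suc e) (letter i s t)) (gray2 p (Suc e) (letter j s' t))"

lemma p_pos: "p > 0" and p_gt_1: "p > 1" and modulus_pos: "p ^ Suc e > 0"
  using p_gt_2 by auto

lemma letter_less: "letter i s t < p ^ Suc e"
  using modulus_pos by (simp add: letter_def)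

lemma cell_dist_eq:
  "cell_dist i s j s' t
    = gray_weight p (p ^ e) ((letter j s' t + (p ^ Suc e - letter i s t)) mod p ^ Suc e)"
  unfolding cell_dist_def using p_gt_1 letter_less by (rule hamming_dist_gray2)

lemma cell_dist_le: "cell_dist i s j s' t \<le> p ^ e"
  by (simp add: cell_dist_eq gray_weight_le)

lemma letter_eq_iff:
  assumes "s < p ^ Suc e" "s' < p ^ Suc e"
  shows "letter i s t = letter i s' t \<longleftrightarrow> s = s'"
  using assms inj_onD[OF inj_on_shift_mod[of "E $$ (i, t)" "p ^ Suc e"], of s s']
  by (auto simp: letter_def simp del: power_Suc)

lemma cell_dist_same_row_pos:
  assumes "s < p ^ Suc e" "s' < p ^ Suc e" "s \<noteq> s'"
  shows "cell_dist i s i s' t > 0"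
proof -
  let ?m = "p ^ Suc e" and ?x = "letter i s t" and ?y = "letter i s' t"
  have "(?y + (?m - ?x)) mod ?m \<noteq> 0"
  proof
    assume 0: "(?y + (?m - ?x)) mod ?m = 0"
    have "?x = (?x + (?y + (?m - ?x)) mod ?m) mod ?m"
      unfolding 0 using letter_less[of i s t] by simp
    also have "\<dots> = (?x + (?y + (?m - ?x))) mod ?m" by (rule mod_add_right_eq)
    also have "?x + (?y + (?m - ?x)) = ?y + ?m" using letter_less[of i s t] by simp
    also have "\<dots> mod ?m = ?y" using letter_less[of i s' t] by simp
    finally show False using assms letter_eq_iff by blast
  qed
  then show ?thesis
    unfolding cell_dist_eq using p_gt_1 modulus_pos by (intro gray_weight_pos) auto
qed

lemma cell_dist_unit_shift: "cell_dist i 0 i 1 t = 1"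
proof -
  let ?m = "p ^ Suc e" and ?x = "letter i 0 t"
  have m: "?m > 1" using p_gt_1 by (metis one_less_power zero_less_Suc)
  have "(letter i 1 t + (?m - ?x)) mod ?m = (E $$ (i, t) + 1 + (?m - ?x)) mod ?m"
    unfolding letter_def by (rule mod_add_left_eq)
  \<comment> \<open>The indices are arbitrary here, so the entry is split into its remainder
    \<open>?x\<close> and a multiple of \<open>?m\<close>.\<close>
  also have "E $$ (i, t) + 1 + (?m - ?x) = 1 + Suc (E $$ (i, t) div ?m) * ?m"
  proof -
    have "E $$ (i, t) = ?x + E $$ (i, t) div ?m * ?m" by (simp add: letter_def mod_div_mult_eq del: power_Suc)
    then show ?thesis using letter_less[of i 0 t] unfolding mult_Suc by linarith
  qed
  also have "\<dots> mod ?m = 1" using m unfolding mod_mult_self1 by (rule mod_less)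
  finally show ?thesis unfolding cell_dist_eq using gray_weight_1 p_gt_1 by simp
qed

text \<open>The root sum of the letter differences is the inner product of the two rows times a
  constant coming from the shifts, so it vanishes for any shifts.\<close>

lemma sum_cell_dist:
  assumes ij: "i < n" "j < n" "i \<noteq> j"
  shows "(\<Sum>t<n. cell_dist i s j s' t) = n * (p - 1) * p ^ (e - 1)"
proof -
  let ?m = "p ^ Suc e"
  let ?d = "\<lambda>t. (letter j s' t + (?m - letter i s t)) mod ?m"
  have "\<zeta> ^ ?d t = \<zeta> ^ s' * cnj (\<zeta> ^ s) * (\<zeta> ^ (E $$ (j, t)) * cnj (\<zeta> ^ (E $$ (i, t))))" for t
  proof -
    have power_letter: "\<zeta> ^ letter i s t = \<zeta> ^ (E $$ (i, t)) * \<zeta> ^ s" for i s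
      unfolding letter_def primitive_root_power_mod[OF primitive] by (rule power_add)
    have "\<zeta> ^ (?m - letter i s t) = cnj (\<zeta> ^ letter i s t)"
      using letter_less by (intro primitive_root_power_diff[OF primitive] less_imp_le)
    then show ?thesis
      unfolding primitive_root_power_mod[OF primitive] power_add[of \<zeta> "letter j s' t"] power_letter
      by (simp add: ac_simps)
  qed
  then have "(\<Sum>t<n. \<zeta> ^ ?d t)
      = \<zeta> ^ s' * cnj (\<zeta> ^ s) * (\<Sum>t<n. \<zeta> ^ (E $$ (j, t)) * cnj (\<zeta> ^ (E $$ (i, t))))"
    by (simp only: sum_distrib_left)
  also have "\<dots> = 0" using orthogonal[OF ij(2,1)] ij(3) by simp
  finally have "(\<Sum>t<n. \<zeta> ^ ?d t) = 0" .
  moreover have "?d t < ?m" for t using modulus_pos by simp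
  ultimately have "p * (\<Sum>t\<in>{..<n}. gray_weight p (p ^ e) (?d t)) = card {..<n} * (p - 1) * p ^ e"
    by (intro sum_gray_weight_vanishing[OF prime primitive]) auto
  then have "p * (\<Sum>t<n. cell_dist i s j s' t) = n * (p - 1) * p ^ e"
    by (simp add: cell_dist_eq del: power_Suc)
  also have "\<dots> = p * (n * (p - 1) * p ^ (e - 1))"
    using e_pos by (cases e) auto
  finally show ?thesis using p_pos by simp
qed

lemma sum_cell_dist_ge:
  assumes "i < n" "j < n" "i \<noteq> j"
  shows "(\<Sum>t<n. cell_dist i s j s' t) \<ge> n"
proof -
  have "n * 1 \<le> n * ((p - 1) * p ^ (e - 1))"
    using p_gt_1 by (intro mult_left_mono) auto
  then show ?thesis unfolding sum_cell_dist[OF assms] by (simp add: mult.assoc)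
qed

section \<open>The Gray images as indexed families of words\<close>

lemma hamming_dist_gray_word:
  "hamming_dist (gray_word [a..<b] (i, s)) (gray_word [a..<b] (j, s'))
    = (\<Sum>t\<in>{a..<b}. cell_dist i s j s' t)"
  "length (gray_word [a..<b] (i, s)) = length (gray_word [a..<b] (j, s'))"
proof -
  have "length (gray2 p (Suc e) (letter i s t)) = length (gray2 p (Suc e) (letter j s' t))" for t
    using p_pos by (simp add: length_gray2)
  from hamming_dist_concat[where js = "[a..<b]", OF this]
  show "hamming_dist (gray_word [a..<b] (i, s)) (gray_word [a..<b] (j, s'))
      = (\<Sum>t\<in>{a..<b}. cell_dist i s j s' t)"
    "length (gray_word [a..<b] (i, s)) = length (gray_word [a..<b] (j, s'))"
    by (simp_all add: gray_word_def cell_dist_def interv_sum_list_conv_sum_set_nat comp_def)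
qed

lemma row_words_shift:
  "row_words (exponent_matrix (p ^ Suc e) \<zeta> (\<zeta> ^ s \<cdot>\<^sub>m map_mat (\<lambda>a. \<zeta> ^ a) E))
    = (\<lambda>i. map (letter i s) [0..<n]) ` {..<n}"
  unfolding exponent_matrix_shift[OF primitive] row_words_def
  using carrier by (intro image_cong) (auto simp: list_of_row letter_def simp del: power_Suc)

lemma gray2_code_C:
  "gray2_code p (Suc e) (code_C (p ^ Suc e) \<zeta> (map_mat (\<lambda>a. \<zeta> ^ a) E))
    = gray_word [0..<n] ` ({..<n} \<times> {..<p ^ Suc e})"
  unfolding gray2_code_def code_C_def roots_of_unity_eq_powers[OF primitive] image_image
    UN_simps row_words_shift gray_word_def
  by (force simp: image_iff)

lemma gray2_code_B:
  "gray2_code p (Suc e) (code_B (p ^ Suc e) \<zeta> (map_mat (\<lambda>a. \<zeta> ^ a) E))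
    = gray_word [1..<n] ` ({..<n} \<times> {..<p ^ Suc e})"
  unfolding gray2_code_def code_B_def roots_of_unity_eq_powers[OF primitive] image_image
    UN_simps row_words_shift gray_word_def map_tl[symmetric] tl_upt One_nat_def
  by (force simp: image_iff)

lemma gray2_code_A:
  "gray2_code p (Suc e) (code_A E) = (\<lambda>i. gray_word [1..<n] (i, 0)) ` {..<n}"
  unfolding gray2_code_def code_A_def row_words_def image_image list_of_row gray_word_def
    map_tl[symmetric] tl_upt
  using carrier entry_less
  by (intro image_cong) (auto simp: letter_def intro!: arg_cong[where f = concat])

lemma gray2_code_D:
  "gray2_code p (Suc e) (code_D (p ^ Suc e) E c)
    = (\<lambda>(i, s). gray_word [0..<n] (i, s) @ gray2 p (Suc e) (E $$ (i, c))) ` ({..<n} \<times> {..<p ^ Suc e})"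
  unfolding gray2_code_def code_D_def gray_word_def letter_def
  using carrier by (force simp: image_iff)

section \<open>Minimum distances of the four codes\<close>

text \<open>The code is equidistant: every row starts with exponent 0, so the deleted column
  contributes nothing.\<close>

lemma min_dist_A:
  assumes "n \<ge> 2"
  shows "min_dist (gray2_code p (Suc e) (code_A E)) = n * (p - 1) * p ^ (e - 1)"
proof (rule min_dist_image_eqI[OF gray2_code_A])
  have d: "hamming_dist (gray_word [1..<n] (i, 0)) (gray_word [1..<n] (j, 0)) = n * (p - 1) * p ^ (e - 1)"
    if ij: "i < n" "j < n" "i \<noteq> j" for i j
  proof -
    have "cell_dist i 0 j 0 0 = 0"
      using ij first_column by (simp add: cell_dist_def letter_def)
    moreover have "{..<n} = insert 0 {1..<n}" using n_pos by auto
    ultimately have "(\<Sum>t<n. cell_dist i 0 j 0 t) = (\<Sum>t\<in>{1..<n}. cell_dist i 0 j 0 t)"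
      by simp
    then show ?thesis using sum_cell_dist[OF ij] unfolding hamming_dist_gray_word(1) by simp
  qed
  show "n * (p - 1) * p ^ (e - 1) \<le> hamming_dist (gray_word [1..<n] (i, 0)) (gray_word [1..<n] (j, 0))"
    if "i \<in> {..<n}" "j \<in> {..<n}" "i \<noteq> j" for i j
    using d[of i j] that by simp
  show "0 \<in> {..<n}" "1 \<in> {..<n}"
    "hamming_dist (gray_word [1..<n] (0, 0)) (gray_word [1..<n] (1, 0)) = n * (p - 1) * p ^ (e - 1)"
    using assms d[of 0 1] by auto
  show "0 < n * (p - 1) * p ^ (e - 1)" using n_pos p_gt_1 by simp
qed

lemma sum_same_row_ge:
  assumes "s < p ^ Suc e" "s' < p ^ Suc e" "s \<noteq> s'"
  shows "(\<Sum>t\<in>J. cell_dist i s i s' t) \<ge> card J"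
proof -
  have "(\<Sum>t\<in>J. cell_dist i s i s' t) \<ge> (\<Sum>t\<in>J. 1)"
    using cell_dist_same_row_pos[OF assms] by (intro sum_mono) (simp add: Suc_le_eq)
  then show ?thesis by simp
qed

lemma min_dist_B:
  assumes "n \<ge> 2"
  shows "min_dist (gray2_code p (Suc e) (code_B (p ^ Suc e) \<zeta> (map_mat (\<lambda>a. \<zeta> ^ a) E))) = n - 1"
proof (rule min_dist_image_eqI[OF gray2_code_B])
  fix a b
  assume ab: "a \<in> {..<n} \<times> {..<p ^ Suc e}" "b \<in> {..<n} \<times> {..<p ^ Suc e}" "a \<noteq> b"
  obtain i s j s' where a: "a = (i, s)" and b: "b = (j, s')" by (metis surj_pair)
  have "n - 1 \<le> (\<Sum>t\<in>{1..<n}. cell_dist i s j s' t)"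
  proof (cases "i = j")
    case True
    then show ?thesis using sum_same_row_ge[of s s' "{1..<n}" i] ab a b by auto
  next
    case False
    \<comment> \<open>The deleted cell costs at most \<open>p ^ e = p * P\<close>, so it suffices
      that \<open>p + (n - 1) \<le> n * (p - 1)\<close>. This holds since \<open>p \<ge> 3\<close>
      and \<open>n \<ge> 2\<close>, as the substitution by \<open>q\<close> and \<open>r\<close>
      shows.\<close>
    define P where "P = p ^ (e - 1)"
    have P: "P > 0" using p_pos by (simp add: P_def)
    obtain q r where "p = q + 3" "n = r + 2"
      using p_gt_2 assms by (metis add.commute le_Suc_ex Suc_leI numeral_3_eq_3 numeral_2_eq_2)
    then have "p + (n - 1) \<le> n * (p - 1)" by (simp add: algebra_simps)
    then have "(p + (n - 1)) * P \<le> n * (p - 1) * P" by (rule mult_right_mono) simp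
    moreover have "n - 1 \<le> (n - 1) * P" using P by simp
    moreover have "cell_dist i s j s' 0 \<le> p * P"
      using cell_dist_le[of i s j s' 0] e_pos unfolding P_def by (cases e) auto
    moreover have "n * (p - 1) * P = cell_dist i s j s' 0 + (\<Sum>t\<in>{1..<n}. cell_dist i s j s' t)"
    proof -
      have "i < n" "j < n" using ab a b by auto
      moreover have "{..<n} = insert 0 {1..<n}" using n_pos by auto
      ultimately show ?thesis
        using sum_cell_dist[of i j s s'] False unfolding P_def by simp
    qed
    ultimately show ?thesis unfolding add_mult_distrib by linarith
  qed
  then show "n - 1 \<le> hamming_dist (gray_word [1..<n] a) (gray_word [1..<n] b)"
    unfolding a b hamming_dist_gray_word(1) .
next
  show "(0, 0) \<in> {..<n} \<times> {..<p ^ Suc e}" "(0, 1) \<in> {..<n} \<times> {..<p ^ Suc e}"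
    using n_pos p_gt_1 one_less_power[of p "Suc e"] by auto
  show "hamming_dist (gray_word [1..<n] (0, 0)) (gray_word [1..<n] (0, 1)) = n - 1"
    unfolding hamming_dist_gray_word(1) cell_dist_unit_shift by simp
qed (use assms in simp)

lemma sum_cell_dist_full_ge:
  assumes "i < n" "j < n" "s < p ^ Suc e" "s' < p ^ Suc e" "(i, s) \<noteq> (j, s')"
  shows "(\<Sum>t<n. cell_dist i s j s' t) \<ge> n"
  using sum_cell_dist_ge[of i j s s'] sum_same_row_ge[of s s' "{..<n}" i] assms
  by (cases "i = j") auto

lemma min_dist_C:
  "min_dist (gray2_code p (Suc e) (code_C (p ^ Suc e) \<zeta> (map_mat (\<lambda>a. \<zeta> ^ a) E))) = n"
proof (rule min_dist_image_eqI[OF gray2_code_C])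
  fix a b
  assume ab: "a \<in> {..<n} \<times> {..<p ^ Suc e}" "b \<in> {..<n} \<times> {..<p ^ Suc e}" "a \<noteq> b"
  obtain i s j s' where a: "a = (i, s)" and b: "b = (j, s')" by (metis surj_pair)
  show "n \<le> hamming_dist (gray_word [0..<n] a) (gray_word [0..<n] b)"
    using sum_cell_dist_full_ge[of i j s s'] ab
    unfolding a b hamming_dist_gray_word(1) atLeast0LessThan by auto
next
  show "(0, 0) \<in> {..<n} \<times> {..<p ^ Suc e}" "(0, 1) \<in> {..<n} \<times> {..<p ^ Suc e}"
    using n_pos p_gt_1 one_less_power[of p "Suc e"] by auto
  show "hamming_dist (gray_word [0..<n] (0, 0)) (gray_word [0..<n] (0, 1)) = n"
    unfolding hamming_dist_gray_word(1) cell_dist_unit_shift by simp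
qed (use n_pos in simp)

text \<open>The appended letter ignores the shift: it adds nothing between two shifts of one row and
  can only increase other distances. The minimum is therefore exactly \<open>n\<close>.\<close>

lemma min_dist_D: "min_dist (gray2_code p (Suc e) (code_D (p ^ Suc e) E c)) = n"
proof (rule min_dist_image_eqI[OF gray2_code_D])
  let ?F = "\<lambda>(i, s). gray_word [0..<n] (i, s) @ gray2 p (Suc e) (E $$ (i, c))"
  have F: "hamming_dist (?F (i, s)) (?F (j, s')) = (\<Sum>t<n. cell_dist i s j s' t)
      + hamming_dist (gray2 p (Suc e) (E $$ (i, c))) (gray2 p (Suc e) (E $$ (j, c)))" for i s j s'
    using hamming_dist_gray_word[of 0 n i s j s'] p_pos
    by (simp add: hamming_dist_append length_gray2 atLeast0LessThan)
  {
    fix a b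
    assume "a \<in> {..<n} \<times> {..<p ^ Suc e}" "b \<in> {..<n} \<times> {..<p ^ Suc e}" "a \<noteq> b"
    then show "n \<le> hamming_dist (?F a) (?F b)"
      using sum_cell_dist_full_ge F
      by (cases a; cases b) (auto simp del: power_Suc split del: prod.split intro: trans_le_add1)
  }
  show "hamming_dist (?F (0, 0)) (?F (0, 1)) = n"
    unfolding F cell_dist_unit_shift by simp
  show "(0, 0) \<in> {..<n} \<times> {..<p ^ Suc e}" "(0, 1) \<in> {..<n} \<times> {..<p ^ Suc e}"
    using n_pos p_gt_1 one_less_power[of p "Suc e"] by auto
qed (use n_pos in simp)

end


text \<open>For \<open>n = 1\<close> the words of the codes A and B are empty, so no two of them
  differ; this explains the guards \<open>n \<ge> 2\<close>.\<close>

theorem theorem4: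
  fixes p k n :: nat and \<zeta> :: complex and H :: "complex mat" and H' :: "nat mat"
  assumes "prime p" and "p > 2" and "k \<ge> 2" and "n \<ge> 1"
    and "primitive_root_of_unity (p ^ k) \<zeta>"
    and "H' \<in> carrier_mat n n" and "elements_mat H' \<subseteq> {0..<p ^ k}"
    and "H = map_mat (\<lambda>a. \<zeta> ^ a) H'"
    and "butson_hadamard (p ^ k) n H" and "normalized H"
  shows "(n \<ge> 2 \<longrightarrow> min_dist (gray2_code p k (code_A H')) = n * (p - 1) * p ^ (k - 2)) \<and>
    (n \<ge> 2 \<longrightarrow> min_dist (gray2_code p k (code_B (p ^ k) \<zeta> H)) = n - 1) \<and>
    min_dist (gray2_code p k (code_C (p ^ k) \<zeta> H)) = n \<and>
    (n = p ^ k \<longrightarrow>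
      (\<forall>c \<in> {1..<n}. min_dist (gray2_code p k (code_D (p ^ k) H' c)) \<in> {n, n + 1}))"
proof -
  obtain e where k: "k = Suc e" and e: "e > 0"
    using assms(3) by (cases k) auto
  note primitive = assms(5) and carrier = assms(6) and H = assms(8)
  have entry: "H' $$ (i, t) < p ^ k" if "i < n" "t < n" for i t
    using assms(7) elements_matI[OF carrier that refl] by auto
  \<comment> \<open>Normalization speaks of the roots; uniqueness of exponents below
    \<open>p ^ k\<close> transfers it to \<open>H'\<close>.\<close>
  have first_column: "H' $$ (i, 0) = 0" if "i < n" for i
  proof (rule primitive_root_power_inj[OF primitive])
    show "\<zeta> ^ (H' $$ (i, 0)) = \<zeta> ^ 0"
      using assms(10) that carrier unfolding normalized_def H by auto
  qed (use entry[of i 0] that assms(1) prime_gt_0_nat in auto)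
  have orthogonal: "(\<Sum>t<n. \<zeta> ^ (H' $$ (i, t)) * cnj (\<zeta> ^ (H' $$ (j, t)))) = 0"
    if "i < n" "j < n" "i \<noteq> j" for i j
  proof -
    have "H \<in> carrier_mat n n" and "H * mat_adjoint H = of_nat n \<cdot>\<^sub>m 1\<^sub>m n"
      using assms(9) by (auto simp: butson_hadamard_def)
    then have "(\<Sum>t<n. H $$ (i, t) * cnj (H $$ (j, t))) = 0"
      using that mult_mat_adjoint_index[of H n i j] by simp
    then show ?thesis using that carrier by (simp add: H)
  qed
  interpret butson_exponents p e n \<zeta> H'
    using assms(1,2,4) e primitive carrier entry first_column orthogonal
    unfolding k by unfold_locales auto
  show ?thesis
    using min_dist_A min_dist_B min_dist_C min_dist_D e unfolding H k
    by (simp add: numeral_2_eq_2 del: power_Suc)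
qed

end
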